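(* Let $n \ge 1$ and let $G=(V,E)$ be the complete graph on the vertex set $V=\{1,\ldots,n\}$ (so $E$ consists of all unordered pairs $\{i,j\}$ with $i\neq j$). Let $L$ be a nonempty finite set of labels with $|L|=k$, let $d$ be a metric on $L$, and for each $i \in V$ let $m_i : L \to \mathbb{R}$ be a non-negative function. For a labeling $x=(x_1,\ldots,x_n) \in L^n$ define $$c(x) = \sum_{i \in V} m_i(x_i) + \sum_{\{i,j\} \in E} d(x_i,x_j),$$ and let $x^*$ be a minimizer of $c$ over $L^n$. For each $r \in V$ define $$c^r(x) = \sum_{i \in V} \frac{m_i(x_i)}{n} + \sum_{j \in V\setminus\{r\}} \frac{d(x_r,x_j)}{2}.$$ Consider the following algorithm. For each $r \in V$, compute $x^r \in L^n$ by $$x^r_r \in \operatorname{argmin}_{x_r \in L} \left( \frac{m_r(x_r)}{n} + \sum_{j \in V\setminus\{r\}} \min_{x_j \in L} \left( \frac{m_j(x_j)}{n} + \frac{d(x_r,x_j)}{2} \right) \right),$$ $$x^r_j \in \operatorname{argmin}_{x_j \in L} \left( \frac{m_j(x_j)}{n} + \frac{d(x^r_r,x_j)}{2} \right) \quad (j \in V\setminus\{r\}),$$ with ties broken arbitrarily. Then choose $\hat{r} \in \operatorname{argmin}_{r \in V} c^r(x^r)$ (ties broken arbitrarily) and output $\hat{x} = x^{\hat r}$. Then the output satisfies $$c(\hat{x}) \le 2\, c(x^* ).$$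
   Context: This is the unweighted metric labeling problem on a complete graph: assign a label from $L$ to each vertex to minimize the sum of per-vertex costs $m_i(x_i)$ plus the metric distances between labels of all pairs of distinct vertices. Each $c^r$ is a metric labeling objective on a star graph rooted at $r$, and the stated procedure computes a minimizer $x^r$ of $c^r$ over $L^n$. *)

theory Defs
  imports "HOL-Analysis.Analysis"
begin

definition vertices :: "nat \<Rightarrow> nat set" where
  "vertices n = {1..n}"

definition edges :: "nat \<Rightarrow> nat set set" where
  "edges n = {{i, j} |i j. i \<in> vertices n \<and> j \<in> vertices n \<and> i \<noteq> j}"

definition labelings :: "nat \<Rightarrow> 'l set \<Rightarrow> (nat \<Rightarrow> 'l) set" where
  "labelings n L = vertices n \<rightarrow>\<^sub>E L"

text \<open>
  An edge is a two-element set of vertices, so its endpoints are its minimum and its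
  maximum; as \<open>d\<close> is symmetric, the order in which they are passed is irrelevant
  (see \<open>edge_distance\<close> below).
\<close>
definition cost ::
    "nat \<Rightarrow> (nat \<Rightarrow> 'l \<Rightarrow> real) \<Rightarrow> ('l \<Rightarrow> 'l \<Rightarrow> real) \<Rightarrow> (nat \<Rightarrow> 'l) \<Rightarrow> real" where
  "cost n m d x =
     (\<Sum>i\<in>vertices n. m i (x i)) + (\<Sum>e\<in>edges n. d (x (Min e)) (x (Max e)))"

lemma edge_distance:
  fixes d :: "'l \<Rightarrow> 'l \<Rightarrow> real" and x :: "nat \<Rightarrow> 'l"
  assumes "Metric_space L d"
  shows "d (x (Min {i, j})) (x (Max {i, j})) = d (x i) (x j)"
  using Metric_space.commute[OF assms] by (cases "i \<le> j") (auto simp: min_def max_def)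

definition star_cost ::
    "nat \<Rightarrow> (nat \<Rightarrow> 'l \<Rightarrow> real) \<Rightarrow> ('l \<Rightarrow> 'l \<Rightarrow> real) \<Rightarrow> nat \<Rightarrow> (nat \<Rightarrow> 'l) \<Rightarrow> real" where
  "star_cost n m d r x =
     (\<Sum>i\<in>vertices n. m i (x i) / real n) + (\<Sum>j\<in>vertices n - {r}. d (x r) (x j) / 2)"

definition leaf_cost ::
    "nat \<Rightarrow> (nat \<Rightarrow> 'l \<Rightarrow> real) \<Rightarrow> ('l \<Rightarrow> 'l \<Rightarrow> real) \<Rightarrow> 'l \<Rightarrow> nat \<Rightarrow> 'l \<Rightarrow> real" where
  "leaf_cost n m d a j b = m j b / real n + d a b / 2"

definition root_cost ::
    "nat \<Rightarrow> 'l set \<Rightarrow> (nat \<Rightarrow> 'l \<Rightarrow> real) \<Rightarrow> ('l \<Rightarrow> 'l \<Rightarrow> real) \<Rightarrow> nat \<Rightarrow> 'l \<Rightarrow> real" where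
  "root_cost n L m d r a =
     m r a / real n + (\<Sum>j\<in>vertices n - {r}. Min (leaf_cost n m d a j ` L))"

text \<open>
  Ties may be broken arbitrarily, so the results of the algorithm are described by
  predicates satisfied by every labeling that some choice of minimizers can produce.
\<close>
definition star_output ::
    "nat \<Rightarrow> 'l set \<Rightarrow> (nat \<Rightarrow> 'l \<Rightarrow> real) \<Rightarrow> ('l \<Rightarrow> 'l \<Rightarrow> real) \<Rightarrow> nat \<Rightarrow> (nat \<Rightarrow> 'l) \<Rightarrow> bool" where
  "star_output n L m d r x \<longleftrightarrow>
     x \<in> labelings n L \<and>
     is_arg_min (root_cost n L m d r) (\<lambda>a. a \<in> L) (x r) \<and>
     (\<forall>j\<in>vertices n - {r}. is_arg_min (leaf_cost n m d (x r) j) (\<lambda>b. b \<in> L) (x j))"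

definition algorithm_output ::
    "nat \<Rightarrow> 'l set \<Rightarrow> (nat \<Rightarrow> 'l \<Rightarrow> real) \<Rightarrow> ('l \<Rightarrow> 'l \<Rightarrow> real) \<Rightarrow> (nat \<Rightarrow> 'l) \<Rightarrow> bool" where
  "algorithm_output n L m d y \<longleftrightarrow>
     (\<exists>xs r. (\<forall>s\<in>vertices n. star_output n L m d s (xs s)) \<and>
             is_arg_min (\<lambda>s. star_cost n m d s (xs s)) (\<lambda>s. s \<in> vertices n) r \<and>
             y = xs r)"

end

theory Submission
  imports Defs
begin

text \<open>
  Summing the star objectives over all roots counts every edge twice with weight one half, so
  \<open>\<Sum>r. c\<^sup>r(x) = c(x)\<close>. Since \<open>x\<^sup>r\<close> minimizes \<open>c\<^sup>r\<close>, the best star labeling satisfies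
  \<open>n * c\<^sup>r(x\<^sup>r) \<le> \<Sum>s. c\<^sup>s(x\<^sup>*) = c(x\<^sup>*)\<close>. Conversely, routing every distance
  through the root by the triangle inequality gives \<open>c(x) \<le> 2 * n * c\<^sup>r(x)\<close> for every \<open>x\<close>.
\<close>

lemma finite_vertices [simp]: "finite (vertices n)"
  by (simp add: vertices_def)

lemma labelings_mem: "x \<in> labelings n L \<Longrightarrow> i \<in> vertices n \<Longrightarrow> x i \<in> L"
  by (auto simp: labelings_def)

text \<open>Replaces unordered edges by ordered pairs: pairs above and below the diagonal contribute
  equally by symmetry of \<open>d\<close>, and the diagonal contributes zero.\<close>

lemma sum_edges:
  fixes d :: "'l \<Rightarrow> 'l \<Rightarrow> real"
  assumes "Metric_space L d" and x: "x \<in> labelings n L"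
  shows "(\<Sum>e\<in>edges n. d (x (Min e)) (x (Max e))) =
         (\<Sum>i\<in>vertices n. \<Sum>j\<in>vertices n. d (x i) (x j)) / 2"
proof -
  interpret Metric_space L d by fact
  let ?V = "vertices n" and ?f = "\<lambda>(i, j). d (x i) (x j)"
  define A where "A = {(i, j). i \<in> ?V \<and> j \<in> ?V \<and> i < j}"
  define B where "B = {(i, j). i \<in> ?V \<and> j \<in> ?V \<and> j < i}"
  define D where "D = {(i, j). i \<in> ?V \<and> j \<in> ?V \<and> i = j}"
  have split: "?V \<times> ?V = A \<union> B \<union> D"
    by (auto simp: A_def B_def D_def)
  have "finite (?V \<times> ?V)"
    by simp
  then have fin: "finite A" "finite B" "finite D"
    unfolding split by simp_all
  have disj: "A \<inter> B = {}" "(A \<union> B) \<inter> D = {}"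
    by (auto simp: A_def B_def D_def)
  \<comment> \<open>Each edge corresponds to exactly one increasing pair, namely
    \<open>(Min e, Max e)\<close>.\<close>
  have edges_A: "(\<Sum>e\<in>edges n. d (x (Min e)) (x (Max e))) = sum ?f A"
  proof (rule sum.reindex_bij_witness[of _ "\<lambda>(i, j). {i, j}" "\<lambda>e. (Min e, Max e)"])
    fix e assume "e \<in> edges n"
    then obtain i j where e: "e = {i, j}" "i \<in> ?V" "j \<in> ?V" "i \<noteq> j"
      by (auto simp: edges_def)
    show "(case (Min e, Max e) of (i, j) \<Rightarrow> {i, j}) = e"
      using e by (auto simp: min_def max_def)
    show "(Min e, Max e) \<in> A"
      using e by (auto simp: A_def min_def max_def)
  next
    fix p assume "p \<in> A"
    then show "(Min (case p of (i, j) \<Rightarrow> {i, j}), Max (case p of (i, j) \<Rightarrow> {i, j})) = p"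
      by (auto simp: A_def min_def max_def)
    from \<open>p \<in> A\<close> show "(case p of (i, j) \<Rightarrow> {i, j}) \<in> edges n"
      by (auto simp: A_def edges_def)
  qed simp
  have B_A: "sum ?f B = sum ?f A"
    by (rule sum.reindex_bij_witness[of _ prod.swap prod.swap])
      (auto simp: A_def B_def commute)
  have D_0: "sum ?f D = 0"
    by (rule sum.neutral) (auto simp: D_def labelings_mem[OF x])
  have "(\<Sum>i\<in>?V. \<Sum>j\<in>?V. d (x i) (x j)) = sum ?f (?V \<times> ?V)"
    by (simp add: sum.cartesian_product)
  also have "\<dots> = sum ?f A + sum ?f B + sum ?f D"
    unfolding split using fin disj by (simp add: sum.union_disjoint)
  finally show ?thesis
    using edges_A B_A D_0 by simp
qed

text \<open>The added term \<open>j = r\<close> is a distance from a label to itself, hence zero.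
  The index set then no longer depends on \<open>r\<close>, so sums over roots become double
  sums.\<close>

lemma star_cost_eq_full_sum:
  fixes d :: "'l \<Rightarrow> 'l \<Rightarrow> real"
  assumes "Metric_space L d" and "x \<in> labelings n L" and "r \<in> vertices n"
  shows "star_cost n m d r x =
         (\<Sum>i\<in>vertices n. m i (x i)) / real n + (\<Sum>j\<in>vertices n. d (x r) (x j)) / 2"
proof -
  have "d (x r) (x r) = 0"
    using Metric_space.zero[OF assms(1)] labelings_mem[OF assms(2,3)] by simp
  then have "(\<Sum>j\<in>vertices n - {r}. d (x r) (x j) / 2) = (\<Sum>j\<in>vertices n. d (x r) (x j) / 2)"
    using assms(3) by (simp add: sum.remove)
  then show ?thesis
    by (simp add: star_cost_def sum_divide_distrib)
qed

lemma sum_star_cost: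
  fixes d :: "'l \<Rightarrow> 'l \<Rightarrow> real"
  assumes "n \<ge> 1" and "Metric_space L d" and "x \<in> labelings n L"
  shows "(\<Sum>r\<in>vertices n. star_cost n m d r x) = cost n m d x"
proof -
  have "card (vertices n) = n"
    by (simp add: vertices_def)
  then show ?thesis
    using assms
    by (simp add: star_cost_eq_full_sum cost_def sum_edges sum.distrib flip: sum_divide_distrib)
qed

lemma cost_le_star_cost:
  fixes d :: "'l \<Rightarrow> 'l \<Rightarrow> real"
  assumes "n \<ge> 1" and "Metric_space L d" and x: "x \<in> labelings n L" and r: "r \<in> vertices n"
    and m_nonneg: "\<And>i a. i \<in> vertices n \<Longrightarrow> a \<in> L \<Longrightarrow> m i a \<ge> 0"
  shows "cost n m d x \<le> 2 * real n * star_cost n m d r x"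
proof -
  interpret Metric_space L d by fact
  let ?V = "vertices n"
  have card_V: "card ?V = n"
    by (simp add: vertices_def)
  define M where "M = (\<Sum>i\<in>?V. m i (x i))"
  define R where "R = (\<Sum>j\<in>?V. d (x r) (x j))"
  have "M \<ge> 0"
    unfolding M_def by (rule sum_nonneg) (rule m_nonneg[OF _ labelings_mem[OF x]])
  have "(\<Sum>i\<in>?V. \<Sum>j\<in>?V. d (x i) (x j)) \<le> (\<Sum>i\<in>?V. \<Sum>j\<in>?V. d (x r) (x i) + d (x r) (x j))"
    using r by (intro sum_mono triangle'' labelings_mem[OF x])
  also have "\<dots> = 2 * real n * R"
    by (simp add: sum.distrib card_V R_def flip: sum_distrib_left)
  finally have "cost n m d x \<le> M + real n * R"
    using assms(2) x by (simp add: cost_def sum_edges M_def)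
  \<comment> \<open>Doubling \<open>M\<close> matches the ratio of the two parts in
    \<open>2 * n * (M / n + R / 2)\<close>.\<close>
  also have "\<dots> \<le> 2 * M + real n * R"
    using \<open>M \<ge> 0\<close> by simp
  also have "\<dots> = 2 * real n * star_cost n m d r x"
    using assms(1)
    by (simp add: star_cost_eq_full_sum[OF assms(2) x r] M_def R_def field_simps)
  finally show ?thesis .
qed

text \<open>Once the root label is fixed, the star objective separates into independent terms, one
  per leaf.\<close>

lemma star_cost_eq_leaf_sum:
  assumes "r \<in> vertices n"
  shows "star_cost n m d r x =
         m r (x r) / real n + (\<Sum>j\<in>vertices n - {r}. leaf_cost n m d (x r) j (x j))"
  using assms by (simp add: star_cost_def leaf_cost_def sum.remove[of _ r] sum.distrib)

text \<open>By separation over the leaves, \<open>root_cost\<close> at a label \<open>a\<close> is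
  the least star cost among labelings giving \<open>r\<close> the label \<open>a\<close>. Minimizing
  over \<open>a\<close> then gives a global minimum.\<close>

lemma star_output_optimal:
  assumes "finite L" and r: "r \<in> vertices n"
    and out: "star_output n L m d r x" and y: "y \<in> labelings n L"
  shows "star_cost n m d r x \<le> star_cost n m d r y"
proof -
  have root: "root_cost n L m d r (x r) \<le> root_cost n L m d r (y r)"
    using out labelings_mem[OF y r] by (auto simp: star_output_def is_arg_min_linorder)
  have leaf: "leaf_cost n m d (x r) j (x j) = Min (leaf_cost n m d (x r) j ` L)"
    if "j \<in> vertices n - {r}" for j
    using out that \<open>finite L\<close>
    by (intro Min_eqI[symmetric]) (auto simp: star_output_def is_arg_min_linorder)
  have "star_cost n m d r x = root_cost n L m d r (x r)"
    using leaf by (simp add: star_cost_eq_leaf_sum[OF r] root_cost_def)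
  also note root
  \<comment> \<open>The leaf labels of \<open>y\<close> need not be optimal for its root label, so
    each minimum is only a lower bound here, whereas \<open>x\<close> attains it.\<close>
  also have "root_cost n L m d r (y r) \<le> star_cost n m d r y"
    unfolding star_cost_eq_leaf_sum[OF r] root_cost_def
    using \<open>finite L\<close> labelings_mem[OF y] by (intro add_left_mono sum_mono Min_le) auto
  finally show ?thesis .
qed

theorem theorem2:
  fixes n k :: nat
    and L :: "'l set"
    and d :: "'l \<Rightarrow> 'l \<Rightarrow> real"
    and m :: "nat \<Rightarrow> 'l \<Rightarrow> real"
    and x_opt x_hat :: "nat \<Rightarrow> 'l"
  assumes "n \<ge> 1"
    and "finite L" and "L \<noteq> {}" and "card L = k"
    and "Metric_space L d"
    and "\<And>i a. i \<in> vertices n \<Longrightarrow> a \<in> L \<Longrightarrow> m i a \<ge> 0"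
    and "is_arg_min (cost n m d) (\<lambda>x. x \<in> labelings n L) x_opt"
    and "algorithm_output n L m d x_hat"
  shows "cost n m d x_hat \<le> 2 * cost n m d x_opt"
proof -
  from assms(8) obtain xs r where
    out: "\<And>s. s \<in> vertices n \<Longrightarrow> star_output n L m d s (xs s)"
    and best: "is_arg_min (\<lambda>s. star_cost n m d s (xs s)) (\<lambda>s. s \<in> vertices n) r"
    and hat: "x_hat = xs r"
    by (auto simp: algorithm_output_def)
  have r: "r \<in> vertices n"
    and min: "\<And>s. s \<in> vertices n \<Longrightarrow> star_cost n m d r x_hat \<le> star_cost n m d s (xs s)"
    using best hat by (auto simp: is_arg_min_linorder)
  have opt: "x_opt \<in> labelings n L"
    using assms(7) by (simp add: is_arg_min_def)
  have x_hat: "x_hat \<in> labelings n L"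
    using out[OF r] hat by (simp add: star_output_def)
  have "real n * star_cost n m d r x_hat = (\<Sum>s\<in>vertices n. star_cost n m d r x_hat)"
    by (simp add: vertices_def)
  \<comment> \<open>Termwise through \<open>star_cost n m d s (xs s)\<close>: first the choice of
    \<open>r\<close> as best root, then optimality of \<open>xs s\<close> for its own star.\<close>
  also have "\<dots> \<le> (\<Sum>s\<in>vertices n. star_cost n m d s x_opt)"
    using min star_output_optimal[OF assms(2) _ out opt]
    by (intro sum_mono) (blast intro: order_trans)
  also have "\<dots> = cost n m d x_opt"
    by (rule sum_star_cost[OF assms(1,5) opt])
  finally have "real n * star_cost n m d r x_hat \<le> cost n m d x_opt" .
  moreover have "cost n m d x_hat \<le> 2 * real n * star_cost n m d r x_hat"
    using assms(1,5) x_hat r by (rule cost_le_star_cost) (rule assms(6))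
  ultimately show ?thesis
    by simp
qed

end
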